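(* Fix \(n\geq 3\) and let \(f\) be extremal for \(M_n\). If \(\psi\in\mathrm{Hol}(\mathbb D)\) satisfies \(f\circ\psi=f\) in \(\mathbb D\), then \(\psi\in\mathrm{Aut}(\mathbb D)\). If \(N\geq 3\) then there exists \(a\in\mathbb D\) and an \(N\)th root of unity \(\xi\) such that \[ \psi(z)=\psi_{-a}(\xi\psi_{a}(z)),\qquad \psi_a(z)=\frac{z-a}{1-\overline{a}z}. \] In particular, \(\psi(a)=a\), and \(\psi^{\circ N}=\mathrm{id}\). If \(N=2\) then either \(\psi\) is of the form above, or \(\psi\) fixes \(\{\overline{\alpha_1},\overline{\alpha_2}\}\) and no other points in \(\overline{\mathbb D}\).
   Context: Let \(\mathcal B_0=\{f\in\mathrm{Hol}(\mathbb D)\;|\;0<|f|\leq 1\}\), and for \(f(z)=\sum_{j\geq 0}a_jz^j\in\mathcal B_0\) set \(M_n(f)=\mathrm{Re}\,a_n\). A function \(f\in\mathcal B_0\) (normalized so that \(f(0)>0\)) is called extremal for \(M_n\) if \(M_n(f)\geq M_n(F)\) for every \(F\in\mathcal B_0\). Any such extremal function has the form \[ f(z)=\exp\bigg(-\sum_{j=1}^N\lambda_j\frac{1+\alpha_jz}{1-\alpha_jz}\bigg) \] for some \(N\leq n\), weights \(\lambda_1,\dots,\lambda_N>0\), and distinct points \(\alpha_1,\dots,\alpha_N\in\partial\mathbb D\); \(N\) and \(\alpha_1,\dots,\alpha_N\) in the statement refer to this representation. \(\psi^{\circ N}\) denotes the \(N\)-fold composition of \(\psi\) with itself. *)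

theory Defs
  imports "HOL-Complex_Analysis.Complex_Analysis"
begin

abbreviation unit_disc :: "complex set" where
  "unit_disc \<equiv> ball 0 1"

definition B0 :: "(complex \<Rightarrow> complex) set" where
  "B0 = {f. f holomorphic_on unit_disc \<and> (\<forall>z\<in>unit_disc. 0 < norm (f z) \<and> norm (f z) \<le> 1)}"

definition taylor_coeff :: "nat \<Rightarrow> (complex \<Rightarrow> complex) \<Rightarrow> complex" where
  "taylor_coeff n f = (deriv ^^ n) f 0 / of_nat (fact n)"

definition M :: "nat \<Rightarrow> (complex \<Rightarrow> complex) \<Rightarrow> real" where
  "M n f = Re (taylor_coeff n f)"

definition extremal :: "nat \<Rightarrow> (complex \<Rightarrow> complex) \<Rightarrow> bool" where
  "extremal n f \<longleftrightarrow> f \<in> B0 \<and> Im (f 0) = 0 \<and> Re (f 0) > 0 \<and> (\<forall>F\<in>B0. M n F \<le> M n f)"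

definition disc_aut :: "(complex \<Rightarrow> complex) \<Rightarrow> bool" where
  "disc_aut \<psi> \<longleftrightarrow> \<psi> holomorphic_on unit_disc \<and> \<psi> ` unit_disc \<subseteq> unit_disc \<and>
     (\<exists>g. g holomorphic_on unit_disc \<and> g ` unit_disc \<subseteq> unit_disc \<and>
          (\<forall>z\<in>unit_disc. g (\<psi> z) = z \<and> \<psi> (g z) = z))"

definition blaschke_aut :: "complex \<Rightarrow> complex \<Rightarrow> complex" where
  "blaschke_aut a z = (z - a) / (1 - cnj a * z)"

end

theory Submission
  imports Defs "HOL-Computational_Algebra.Fundamental_Theorem_Algebra"
begin

text \<open>
  Write f = exp (- g) with g the Herglotz sum. Then g \<circ> \<psi> = g + c for a constant c on the imaginary
  axis. As g is a rational function of degree N mapping exactly the disc to the right half plane,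
  \<psi> is proper, hence onto. It maps the fibre of g over w onto the fibre over w + c, and generic
  fibres have N points, so \<psi> is also injective, hence a Moebius transformation. It permutes the N
  poles of g. If \<psi> has a fixed point in the disc, it is conjugate to a rotation by \<xi> that permutes
  N nonzero numbers, and comparing their products gives \<xi>^N = 1. Otherwise \<psi> is conjugate to
  multiplication by a positive number other than 1 (two boundary fixed points) or to a nonzero
  translation (one boundary fixed point); a product or sum over the poles that are not fixed shows
  that all poles are fixed, so N = 2. The case N = 0, where f = 1, is excluded because
  (2 + z^n)/3 has a larger coefficient.
\<close>

section \<open>Finite permutations, complex polynomials and generic injectivity\<close>

text \<open>Permuting \<open>P\<close> does not change the product of \<open>h\<close> over
  \<open>P\<close>, yet multiplies it by \<open>\<mu> ^ card P\<close>; the product is nonzero and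
  cancels. It serves both for rotations and for maps with two boundary fixed points.\<close>

lemma power_card_eq_1_if_multiplied:
  fixes h :: "'a \<Rightarrow> 'b::field"
  assumes "finite P" "inj_on T P" "T ` P = P"
    and "\<And>p. p \<in> P \<Longrightarrow> h (T p) = \<mu> * h p" "\<And>p. p \<in> P \<Longrightarrow> h p \<noteq> 0"
  shows "\<mu> ^ card P = 1"
proof -
  have "prod h P = prod h (T ` P)"
    using assms(3) by simp
  also have "\<dots> = (\<Prod>p\<in>P. \<mu> * h p)"
    unfolding prod.reindex[OF assms(2)] using assms(4) by simp
  also have "\<dots> = \<mu> ^ card P * prod h P"
    by (simp add: prod.distrib)
  finally show ?thesis
    using assms by simp
qed

text \<open>The additive counterpart, for maps with a single boundary fixed point. Characteristic 0
  allows division by \<open>card P\<close>.\<close>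

lemma translation_eq_0_if_translated:
  fixes h :: "'a \<Rightarrow> 'b::field_char_0"
  assumes "finite P" "P \<noteq> {}" "inj_on T P" "T ` P = P"
    and "\<And>p. p \<in> P \<Longrightarrow> h (T p) = h p + \<tau>"
  shows "\<tau> = 0"
proof -
  have "sum h P = sum h (T ` P)"
    using assms(4) by simp
  also have "\<dots> = (\<Sum>p\<in>P. h p + \<tau>)"
    unfolding sum.reindex[OF assms(3)] using assms(5) by simp
  also have "\<dots> = sum h P + of_nat (card P) * \<tau>"
    by (simp add: sum.distrib)
  finally show ?thesis
    using assms by simp
qed

lemma one_minus_cnj_mult_ne_0:
  assumes "norm b < 1" "norm z \<le> 1"
  shows "1 - cnj b * z \<noteq> 0"
proof
  assume "1 - cnj b * z = 0"
  then have "norm b * norm z = 1"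
    by (metis complex_mod_cnj eq_iff_diff_eq_0 norm_mult norm_one)
  moreover have "norm b * norm z \<le> norm b * 1"
    using assms by (intro mult_left_mono) auto
  ultimately show False
    using assms by simp
qed

text \<open>Stating the factorization as an identity in \<open>z\<close> covers a double root and
  yields the relations between roots and coefficients by evaluation.\<close>

lemma complex_quadratic_roots:
  fixes A B C :: complex
  assumes "A \<noteq> 0"
  obtains r s where "\<And>z. A * z^2 + B * z + C = A * (z - r) * (z - s)"
proof
  define d where "d = csqrt (B^2 - 4 * A * C)"
  have d: "d * d = B * B - 4 * A * C"
    by (metis d_def power2_csqrt power2_eq_square)
  fix z
  show "A * z^2 + B * z + C = A * (z - (- B + d) / (2 * A)) * (z - (- B - d) / (2 * A))"
  proof -
    have "A * (z - (- B + d) / (2 * A)) * (z - (- B - d) / (2 * A))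
        = A * z^2 + B * z + (B * B - d * d) / (4 * A)"
      using assms by (simp add: field_simps power2_eq_square)
    then show ?thesis
      using assms d by simp
  qed
qed

text \<open>Without repeated roots the polynomial is a constant times one linear factor per root, so
  it suffices to compare degrees.\<close>

lemma card_roots_rsquarefree:
  fixes p :: "complex poly"
  assumes "rsquarefree p"
  shows "card {z. poly p z = 0} = degree p"
proof -
  have "p \<noteq> 0"
    using assms by (simp add: rsquarefree_def)
  have "degree p = degree (smult (lead_coeff p) (\<Prod>z|poly p z = 0. [:-z, 1:]))"
    using complex_poly_decompose_rsquarefree[OF assms] by simp
  also have "\<dots> = (\<Sum>z|poly p z = 0. degree [:-z, 1:])"
    using \<open>p \<noteq> 0\<close> by (simp add: degree_prod_sum_eq)
  finally show ?thesis
    by simp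
qed

lemma degree_coeff_linear_prod:
  assumes "finite A" "\<And>i. i \<in> A \<Longrightarrow> c i \<noteq> (0::complex)"
  shows "degree (\<Prod>i\<in>A. [:1, c i:]) = card A" "coeff (\<Prod>i\<in>A. [:1, c i:]) (card A) = prod c A"
proof -
  show deg: "degree (\<Prod>i\<in>A. [:1, c i:]) = card A"
    using assms by (subst degree_prod_sum_eq) auto
  have "lead_coeff (\<Prod>i\<in>A. [:1, c i:]) = (\<Prod>i\<in>A. c i)"
    unfolding lead_coeff_prod using assms by (intro prod.cong) auto
  then show "coeff (\<Prod>i\<in>A. [:1, c i:]) (card A) = prod c A"
    using deg by simp
qed

text \<open>If two distinct points shared a value, the open mapping theorem would give disjoint
  neighbourhoods whose images overlap in a nonempty open set. That set is infinite, so it contains a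
  value outside \<open>E\<close> taken twice.\<close>

lemma holomorphic_inj_on_if_generically_inj:
  fixes \<psi> g :: "complex \<Rightarrow> complex"
  assumes \<psi>: "\<psi> holomorphic_on S" and S: "open S" "connected S"
    and nonconst: "\<not> \<psi> constant_on S"
    and fin: "finite E"
    and inj: "\<And>z w. \<lbrakk>z \<in> S; w \<in> S; \<psi> z = \<psi> w; \<psi> z \<notin> E\<rbrakk> \<Longrightarrow> z = w"
  shows "inj_on \<psi> S"
proof
  fix z w assume zw: "z \<in> S" "w \<in> S" "\<psi> z = \<psi> w"
  show "z = w"
  proof (rule ccontr)
    assume "z \<noteq> w"
    then obtain U V where UV: "open U" "open V" "z \<in> U" "w \<in> V" "U \<inter> V = {}"
      by (meson hausdorff)
    have *: "open (\<psi> ` (S \<inter> W))" if "open W" for W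
      using open_mapping_thm[OF \<psi> S _ _ nonconst, of "S \<inter> W"] S that by auto
    have "open (\<psi> ` (S \<inter> U) \<inter> \<psi> ` (S \<inter> V))"
      using * UV by blast
    moreover have "\<psi> z \<in> \<psi> ` (S \<inter> U) \<inter> \<psi> ` (S \<inter> V)"
      using zw UV by blast
    ultimately have "infinite (\<psi> ` (S \<inter> U) \<inter> \<psi> ` (S \<inter> V))"
      using finite_imp_not_open by blast
    then have "\<not> \<psi> ` (S \<inter> U) \<inter> \<psi> ` (S \<inter> V) \<subseteq> E"
      using fin finite_subset by blast
    then obtain x y where "x \<in> S \<inter> U" "y \<in> S \<inter> V" "\<psi> x = \<psi> y" "\<psi> x \<notin> E"
      by (smt (verit) IntE imageE subsetI)
    then show False
      using inj UV by blast
  qed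
qed

lemma exp_eq_1_imp_constant:
  assumes S: "connected S" and cont: "continuous_on S h"
    and exp: "\<And>z. z \<in> S \<Longrightarrow> exp (h z) = (1::complex)" and "S \<noteq> {}"
  obtains c where "Re c = 0" "\<And>z. z \<in> S \<Longrightarrow> h z = c"
proof -
  have "h constant_on S"
  proof (rule continuous_discrete_range_constant[OF S cont])
    fix x assume x: "x \<in> S"
    show "\<exists>e>0. \<forall>y. y \<in> S \<and> h y \<noteq> h x \<longrightarrow> e \<le> norm (h y - h x)"
    proof (intro exI[of _ "1::real"] conjI allI impI zero_less_one)
      fix y assume y: "y \<in> S \<and> h y \<noteq> h x"
      obtain n m :: int where "Re (h y) = 0" "Im (h y) = of_int (2 * n) * pi"
          "Re (h x) = 0" "Im (h x) = of_int (2 * m) * pi"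
        using exp[of y] exp[of x] x y unfolding exp_eq_1 by blast
      then have nm: "h y = of_real (of_int (2 * n) * pi) * \<i>" "h x = of_real (of_int (2 * m) * pi) * \<i>"
        by (simp_all add: complex_eq_iff)
      have "n \<noteq> m"
        using y nm by auto
      then have "1 \<le> \<bar>real_of_int (n - m)\<bar>"
        by linarith
      moreover have "h y - h x = of_real (2 * pi * real_of_int (n - m)) * \<i>"
        by (simp add: nm algebra_simps)
      then have "norm (h y - h x) = 2 * pi * \<bar>real_of_int (n - m)\<bar>"
        by (simp only: norm_mult norm_of_real) (simp add: abs_mult)
      ultimately show "1 \<le> norm (h y - h x)"
        using pi_gt3 mult_mono[of 1 "2 * pi" 1 "\<bar>real_of_int (n - m)\<bar>"] by simp
    qed
  qed
  then obtain c where c: "\<And>z. z \<in> S \<Longrightarrow> h z = c"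
    unfolding constant_on_def by blast
  moreover have "Re c = 0"
    using exp c \<open>S \<noteq> {}\<close> unfolding exp_eq_1 by (metis ex_in_conv)
  ultimately show thesis
    using that by blast
qed

section \<open>Automorphisms of the disc\<close>

lemma Moebius_function_eq_blaschke_aut: "Moebius_function 0 a = blaschke_aut a"
  by (simp add: Moebius_function_simple blaschke_aut_def fun_eq_iff)

lemma blaschke_aut_inverse:
  assumes "norm a < 1" "norm z < 1"
  shows "blaschke_aut (- a) (blaschke_aut a z) = z"
  using Moebius_function_compose[of "- a" a z] assms
  by (simp add: Moebius_function_eq_blaschke_aut)

text \<open>Composing with a Blaschke factor gives a map \<open>h\<close> that fixes 0. The Schwarz
  lemma for \<open>h\<close> and for its left inverse \<open>k\<close> shows that \<open>h\<close>
  preserves the modulus, so \<open>h\<close> is a rotation.\<close>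

lemma disc_automorphism_moebius:
  assumes "disc_aut \<psi>"
  obtains \<zeta> b where "norm \<zeta> = 1" "norm b < 1"
    "\<And>z. z \<in> unit_disc \<Longrightarrow> \<psi> z = \<zeta> * blaschke_aut b z"
proof -
  obtain g where \<psi>: "\<psi> holomorphic_on unit_disc" "\<psi> ` unit_disc \<subseteq> unit_disc"
    and g: "g holomorphic_on unit_disc" "g ` unit_disc \<subseteq> unit_disc"
    and inv: "\<And>z. z \<in> unit_disc \<Longrightarrow> g (\<psi> z) = z" "\<And>z. z \<in> unit_disc \<Longrightarrow> \<psi> (g z) = z"
    using assms unfolding disc_aut_def by blast
  define b where "b = g 0"
  have b: "norm b < 1"
    using g(2) by (force simp: b_def image_subset_iff)
  have bl: "blaschke_aut a holomorphic_on unit_disc" "blaschke_aut a ` unit_disc \<subseteq> unit_disc"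
    if "norm a < 1" for a
    using Moebius_function_holomorphic[of a 0] Moebius_function_norm_lt_1[of a _ 0] that
    unfolding Moebius_function_eq_blaschke_aut by auto
  have bl_inv: "blaschke_aut b (blaschke_aut (- b) z) = z" "blaschke_aut (- b) (blaschke_aut b z) = z"
    if "z \<in> unit_disc" for z
    using blaschke_aut_inverse[of "- b" z] blaschke_aut_inverse[of b z] b that by auto
  define h where "h = \<psi> \<circ> blaschke_aut (- b)"
  define k where "k = blaschke_aut b \<circ> g"
  have mb: "norm (- b) < 1"
    using b by simp
  have comp: "p \<circ> q holomorphic_on unit_disc" "(p \<circ> q) ` unit_disc \<subseteq> unit_disc"
    if "p holomorphic_on unit_disc" "p ` unit_disc \<subseteq> unit_disc"
      "q holomorphic_on unit_disc" "q ` unit_disc \<subseteq> unit_disc" for p q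
    using that by (auto intro: holomorphic_on_compose_gen)
  have h_hol: "h holomorphic_on unit_disc" "h ` unit_disc \<subseteq> unit_disc"
    unfolding h_def by (intro comp \<psi> bl mb)+
  have k_hol: "k holomorphic_on unit_disc" "k ` unit_disc \<subseteq> unit_disc"
    unfolding k_def by (intro comp g bl b)+
  have h0: "h 0 = 0"
    using inv(2)[of 0] by (simp add: h_def b_def blaschke_aut_def)
  have k0: "k 0 = 0"
    by (simp add: k_def b_def blaschke_aut_def)
  have kh: "k (h z) = z" if "z \<in> unit_disc" for z
  proof -
    have "blaschke_aut (- b) z \<in> unit_disc"
      using bl[OF mb] that by blast
    then show ?thesis
      using that bl_inv inv by (simp add: h_def k_def)
  qed
  have norm_h: "norm (h z) = norm z" if "norm z < 1" for z
  proof (rule antisym)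
    show "norm (h z) \<le> norm z"
      using Schwarz_Lemma(1)[OF h_hol(1) h0 _ that] h_hol(2) by (force simp: image_subset_iff)
    have "norm (h z) < 1"
      using h_hol(2) that by (auto simp: image_subset_iff)
    then have "norm (k (h z)) \<le> norm (h z)"
      using Schwarz_Lemma(1)[OF k_hol(1) k0] k_hol(2) by (force simp: image_subset_iff)
    then show "norm z \<le> norm (h z)"
      using kh that by simp
  qed
  have "\<exists>z. norm z < 1 \<and> z \<noteq> 0 \<and> norm (h z) = norm z"
    by (intro exI[of _ "1/2"]) (simp add: norm_h)
  moreover have "norm (h z) < 1" if "norm z < 1" for z
    using norm_h that by simp
  ultimately have "\<exists>\<zeta>. (\<forall>z. norm z < 1 \<longrightarrow> h z = \<zeta> * z) \<and> norm \<zeta> = 1"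
    using Schwarz_Lemma(3)[OF h_hol(1) h0, of 0] by simp
  then obtain \<zeta> where \<zeta>: "norm \<zeta> = 1" "\<And>z. norm z < 1 \<Longrightarrow> h z = \<zeta> * z"
    by blast
  show thesis
  proof (rule that[OF \<zeta>(1) b])
    fix z :: complex assume z: "z \<in> unit_disc"
    then have "blaschke_aut b z \<in> unit_disc"
      using bl[OF b] by blast
    then show "\<psi> z = \<zeta> * blaschke_aut b z"
      using \<zeta>(2)[of "blaschke_aut b z"] bl_inv(2)[OF z] by (simp add: h_def)
  qed
qed

text \<open>In the coordinate \<open>blaschke_aut a\<close> the map is multiplication by
  \<open>\<xi>\<close>, so its \<open>k\<close>-th iterate is multiplication by
  \<open>\<xi> ^ k\<close>.\<close>

lemma conjugate_rotation_form:
  fixes \<psi> :: "complex \<Rightarrow> complex"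
  assumes a: "norm a < 1" and maps: "\<psi> ` unit_disc \<subseteq> unit_disc" and \<xi>: "\<xi> ^ N = 1"
    and conj: "\<And>z. z \<in> unit_disc \<Longrightarrow> blaschke_aut a (\<psi> z) = \<xi> * blaschke_aut a z"
  shows "z \<in> unit_disc \<Longrightarrow> \<psi> z = blaschke_aut (- a) (\<xi> * blaschke_aut a z)"
    and "\<psi> a = a"
    and "z \<in> unit_disc \<Longrightarrow> (\<psi> ^^ N) z = z"
proof -
  have inv: "blaschke_aut (- a) (blaschke_aut a w) = w" if "w \<in> unit_disc" for w
    using blaschke_aut_inverse a that by simp
  show form: "\<psi> z = blaschke_aut (- a) (\<xi> * blaschke_aut a z)" if "z \<in> unit_disc" for z
    using inv[of "\<psi> z"] conj[OF that] subsetD[OF maps imageI[OF that]] by simp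
  show "\<psi> a = a"
    using form[of a] a by (simp add: blaschke_aut_def)
  show "(\<psi> ^^ N) z = z" if z: "z \<in> unit_disc"
  proof -
    have "(\<psi> ^^ k) z \<in> unit_disc \<and> blaschke_aut a ((\<psi> ^^ k) z) = \<xi> ^ k * blaschke_aut a z" for k
    proof (induction k)
      case (Suc k)
      then show ?case
        using subsetD[OF maps imageI, of "(\<psi> ^^ k) z"] conj[of "(\<psi> ^^ k) z"] by simp
    qed (use z in simp)
    from this[of N] show ?thesis
      using \<xi> inv z by (metis mult_1)
  qed
qed

section \<open>Moebius maps of the closed disc and their fixed points\<close>

locale disc_moebius =
  fixes \<zeta> b :: complex
  assumes norm_zeta: "norm \<zeta> = 1" and norm_b: "norm b < 1"
begin

text \<open>The formula makes sense on the closed disc, so \<open>T\<close> can act on points of the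
  unit circle, where a map known only on the open disc has no prescribed values.\<close>

definition T :: "complex \<Rightarrow> complex" where
  "T z = \<zeta> * blaschke_aut b z"

lemma zeta_ne_0: "\<zeta> \<noteq> 0"
  using norm_zeta by auto

lemma denom_ne_0: "norm z \<le> 1 \<Longrightarrow> 1 - cnj b * z \<noteq> 0"
  using norm_b one_minus_cnj_mult_ne_0 by blast

lemma one_minus_norm_b_pos: "1 - (norm b)^2 > 0"
  using norm_b by (simp add: power_less_one_iff abs_square_less_1)

lemma one_minus_b_cnj_b: "1 - b * cnj b = of_real (1 - (norm b)^2)"
  using complex_norm_square[of b] by simp

lemma one_minus_b_cnj_b_ne_0: "1 - b * cnj b \<noteq> 0"
  using one_minus_norm_b_pos unfolding one_minus_b_cnj_b of_real_eq_0_iff by linarith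

text \<open>Taking \<open>w\<close> to be a fixed point turns this identity into a normal form of
  \<open>T\<close> around that point.\<close>

lemma T_diff:
  assumes "norm z \<le> 1" "norm w \<le> 1"
  shows "T z - T w = \<zeta> * (1 - b * cnj b) * (z - w) / ((1 - cnj b * z) * (1 - cnj b * w))"
  using denom_ne_0[OF assms(1)] denom_ne_0[OF assms(2)]
  by (simp add: T_def blaschke_aut_def divide_simps) (simp add: algebra_simps)

lemma inj_on_T: "inj_on T (cball 0 1)"
proof
  fix z w assume zw: "z \<in> cball 0 1" "w \<in> cball 0 1" "T z = T w"
  then have "\<zeta> * (1 - b * cnj b) * (z - w) / ((1 - cnj b * z) * (1 - cnj b * w)) = 0"
    using T_diff[of z w] by simp
  then show "z = w"
    using zw denom_ne_0[of z] denom_ne_0[of w] zeta_ne_0 one_minus_b_cnj_b_ne_0 by simp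
qed

lemma continuous_on_T: "continuous_on (cball 0 1) T"
  unfolding T_def blaschke_aut_def
  by (intro continuous_intros) (use denom_ne_0 in auto)

lemma T_fixed_iff:
  assumes "norm z \<le> 1"
  shows "T z = z \<longleftrightarrow> cnj b * z^2 + (\<zeta> - 1) * z + (- \<zeta> * b) = 0"
  using denom_ne_0[OF assms]
  by (simp add: T_def blaschke_aut_def divide_simps power2_eq_square) (auto simp: algebra_simps)

text \<open>Numerator and denominator of \<open>blaschke_aut a (T z)\<close> both carry the factor
  \<open>1 / (1 - cnj b * z)\<close>. It cancels, leaving \<open>blaschke_aut a z\<close> times a
  constant.\<close>

lemma T_conjugate_rotation:
  assumes "norm a < 1" "T a = a"
  obtains \<xi> where "norm \<xi> = 1"
    "\<And>z. norm z \<le> 1 \<Longrightarrow> blaschke_aut a (T z) = \<xi> * blaschke_aut a z"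
proof
  define \<xi> where "\<xi> = \<zeta> * (1 - b * cnj a) / (1 - cnj b * a)"
  have da: "1 - cnj b * a \<noteq> 0"
    using assms denom_ne_0 by simp
  then have da': "1 - b * cnj a \<noteq> 0"
    by (metis complex_cnj_cnj complex_cnj_diff complex_cnj_mult complex_cnj_one complex_cnj_zero_iff)
  have "norm (1 - b * cnj a) = norm (1 - cnj b * a)"
    by (metis complex_cnj_cnj complex_cnj_diff complex_cnj_mult complex_cnj_one complex_mod_cnj)
  then show "norm \<xi> = 1"
    using norm_zeta da by (simp add: \<xi>_def norm_mult norm_divide)
  fix z :: complex assume z: "norm z \<le> 1"
  have dz: "1 - cnj b * z \<noteq> 0" and daz: "1 - cnj a * z \<noteq> 0"
    using z denom_ne_0 assms(1) one_minus_cnj_mult_ne_0 by auto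
  have cz: "\<zeta> * cnj \<zeta> = 1"
    using norm_zeta by (simp add: complex_norm_square[symmetric])
  have num: "T z - a = \<zeta> * (1 - b * cnj b) * (z - a) / ((1 - cnj b * z) * (1 - cnj b * a))"
    using T_diff[of z a] assms z by simp
  \<comment> \<open>Replacing \<open>a\<close> by \<open>T a\<close> under the conjugation brings in
    \<open>cnj \<zeta>\<close>, which cancels against the \<open>\<zeta>\<close> of
    \<open>T z\<close>.\<close>
  have "1 - cnj a * T z = 1 - cnj (T a) * T z"
    using assms by simp
  also have "\<dots> = 1 - (\<zeta> * cnj \<zeta>) * ((cnj a - cnj b) * (z - b) / ((1 - b * cnj a) * (1 - cnj b * z)))"
    by (simp add: T_def blaschke_aut_def)
  also have "\<dots> = (1 - b * cnj b) * (1 - cnj a * z) / ((1 - b * cnj a) * (1 - cnj b * z))"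
    unfolding cz using dz da' by (simp add: divide_simps) (simp add: algebra_simps)
  finally have den: "1 - cnj a * T z = (1 - b * cnj b) * (1 - cnj a * z) / ((1 - b * cnj a) * (1 - cnj b * z))" .
  show "blaschke_aut a (T z) = \<xi> * blaschke_aut a z"
    unfolding blaschke_aut_def[of a] num den \<xi>_def
    using dz da da' daz one_minus_b_cnj_b_ne_0 by (simp add: divide_simps)
qed


text \<open>The two roots of the fixed-point equation have reciprocal moduli. Either one lies in the
  open disc and \<open>T\<close> is conjugate to a rotation, or both lie on the circle. In the
  latter case no finite nonempty set of non-fixed points is permuted, so \<open>P\<close> consists
  of fixed points.\<close>

lemma T_invariant_set:
  assumes P: "finite P" "P \<subseteq> sphere 0 1" "T ` P = P" and card: "2 \<le> card P"
  shows "(\<exists>a \<xi>. norm a < 1 \<and> \<xi> ^ card P = 1 \<and>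
            (\<forall>z. norm z \<le> 1 \<longrightarrow> blaschke_aut a (T z) = \<xi> * blaschke_aut a z))
       \<or> card P = 2 \<and> {z \<in> cball 0 1. T z = z} = P"
proof -
  have P_le: "norm p \<le> 1" if "p \<in> P" for p
    using P that by auto
  have inj_P: "inj_on T P"
    using inj_on_T P_le by (meson inj_on_subset mem_cball_0 subsetI)
  have elliptic: ?thesis if a: "norm a < 1" "T a = a" for a
  proof -
    obtain \<xi> where \<xi>: "norm \<xi> = 1"
      "\<And>z. norm z \<le> 1 \<Longrightarrow> blaschke_aut a (T z) = \<xi> * blaschke_aut a z"
      using T_conjugate_rotation[OF a] by blast
    have "\<xi> ^ card P = 1"
    proof (rule power_card_eq_1_if_multiplied[OF P(1) inj_P P(3)])
      fix p assume p: "p \<in> P"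
      show "blaschke_aut a (T p) = \<xi> * blaschke_aut a p"
        using \<xi>(2) P_le p by blast
      have "norm p = 1"
        using p P(2) by auto
      then show "blaschke_aut a p \<noteq> 0"
        using a one_minus_cnj_mult_ne_0[of a p] by (auto simp: blaschke_aut_def)
    qed
    then show ?thesis
      using a \<xi> by blast
  qed
  show ?thesis
  \<comment> \<open>For \<open>b = 0\<close> the fixed-point equation is not quadratic, but
    \<open>T\<close> is then itself a rotation about 0.\<close>
  proof (cases "b = 0")
    case True
    then have "T 0 = 0"
      unfolding T_def blaschke_aut_def by simp
    then show ?thesis
      using elliptic[of 0] by simp
  next
    case False
    obtain r s where rs: "\<And>z. cnj b * z^2 + (\<zeta> - 1) * z + (- \<zeta> * b) = cnj b * (z - r) * (z - s)"
      using complex_quadratic_roots[of "cnj b" "\<zeta> - 1" "- \<zeta> * b"] False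
      by (metis complex_cnj_zero_iff)
    have fixed_iff: "T z = z \<longleftrightarrow> z = r \<or> z = s" if "norm z \<le> 1" for z
      using T_fixed_iff[OF that] False unfolding rs by simp
    \<comment> \<open>Evaluation at 0 gives the product of the roots, evaluation at 1 their sum.
      Since \<open>\<zeta>\<close> is unimodular, the product has modulus 1.\<close>
    have prod_rs: "cnj b * (r * s) = - \<zeta> * b"
      using rs[of 0] by simp
    then have "norm b * (norm r * norm s) = norm b"
      using norm_zeta by (metis complex_mod_cnj mult_1 norm_minus_cancel norm_mult)
    then have norm_rs: "norm r * norm s = 1"
      using False by simp
    have sum_rs: "cnj b * (r + s) = 1 - \<zeta>"
      using rs[of 1] prod_rs by (simp add: algebra_simps)
    consider "norm r < 1" | "norm s < 1" | "norm r = 1" "norm s = 1"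
    proof -
      have "norm s = 1" if "norm r = 1"
        using that norm_rs by simp
      moreover have "norm s < 1" if "norm r > 1"
      proof (rule ccontr)
        assume "\<not> norm s < 1"
        then have "norm r * 1 \<le> norm r * norm s"
          by (intro mult_left_mono) auto
        then show False
          using that norm_rs by simp
      qed
      ultimately show ?thesis
        using that by linarith
    qed
    then show ?thesis
    proof cases
      case 1
      then show ?thesis
        using elliptic[of r] fixed_iff[of r] by simp
    next
      case 2
      then show ?thesis
        using elliptic[of s] fixed_iff[of s] by simp
    next
      case 3
      \<comment> \<open>These are the denominators of \<open>T\<close> at its fixed points. Their
        product is the constant in \<open>T_diff\<close>, so one of them cancels around each fixed
        point.\<close>
      define u v where "u = 1 - cnj b * r" and "v = 1 - cnj b * s"
      have uv0: "u \<noteq> 0" "v \<noteq> 0"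
        using denom_ne_0 3 by (auto simp: u_def v_def)
      have uv: "u * v = \<zeta> * (1 - b * cnj b)"
      proof -
        have "u * v = 1 - cnj b * (r + s) + cnj b * (cnj b * (r * s))"
          by (simp add: u_def v_def algebra_simps)
        then show ?thesis
          unfolding sum_rs prod_rs by (simp add: algebra_simps)
      qed
      have Tr: "T r = r" and Ts: "T s = s"
        using fixed_iff 3 by auto
      have T_r: "T z - r = v * (z - r) / (1 - cnj b * z)" if "norm z \<le> 1" for z
        using T_diff[of z r] that 3 Tr uv0
        by (simp add: uv[symmetric] u_def[symmetric])
      have T_s: "T z - s = u * (z - s) / (1 - cnj b * z)" if "norm z \<le> 1" for z
        using T_diff[of z s] that 3 Ts uv0
        by (simp add: uv[symmetric] v_def[symmetric])
      \<comment> \<open>\<open>T\<close> also permutes the non-fixed points of \<open>P\<close>, and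
        on these the coordinates below are finite.\<close>
      define Q where "Q = P - {r, s}"
      have Q: "finite Q" "inj_on T Q"
        using P inj_P by (auto simp: Q_def intro: inj_on_subset)
      have "T ` Q = Q"
      proof (rule endo_inj_surj[OF Q(1) _ Q(2)])
        show "T ` Q \<subseteq> Q"
        proof
          fix y assume "y \<in> T ` Q"
          then obtain q where q: "q \<in> Q" "y = T q"
            by blast
          have "norm q \<le> 1"
            using q P_le by (auto simp: Q_def)
          then have "T q \<noteq> r" "T q \<noteq> s"
            using q T_r[of q] T_s[of q] uv0 denom_ne_0[of q] by (auto simp: Q_def)
          moreover have "T q \<in> P"
            using q P by (auto simp: Q_def)
          ultimately show "y \<in> Q"
            using q by (auto simp: Q_def)
        qed
      qed
      note Q = Q this
      have Q_le: "norm q \<le> 1" if "q \<in> Q" for q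
        using that P_le by (auto simp: Q_def)
      show ?thesis
      proof (cases "r = s")
        case True
        have "Q \<noteq> {}"
        proof
          assume "Q = {}"
          then have "P \<subseteq> {r}"
            using True by (auto simp: Q_def)
          then have "card P \<le> 1"
            using card_mono[of "{r}" P] by simp
          then show False
            using card by simp
        qed
        \<comment> \<open>The coordinate \<open>1 / (z - r)\<close> sends the double fixed point to
          infinity and turns \<open>T\<close> into a translation, whose step is nonzero because
          \<open>b\<close> is.\<close>
        then have "- cnj b / v = 0"
        proof (rule translation_eq_0_if_translated[where h = "\<lambda>z. 1 / (z - r)", OF Q(1) _ Q(2,3)])
          fix q assume q: "q \<in> Q"
          then have "q \<noteq> r"
            by (auto simp: Q_def)
          have "1 / (T q - r) = (1 - cnj b * q) / (v * (q - r))"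
            by (simp add: T_r Q_le q)
          also have "1 - cnj b * q = v - cnj b * (q - r)"
            using True by (simp add: v_def algebra_simps)
          also have "(v - cnj b * (q - r)) / (v * (q - r)) = 1 / (q - r) + (- cnj b / v)"
            using \<open>q \<noteq> r\<close> uv0 by (simp add: field_simps)
          finally show "1 / (T q - r) = 1 / (q - r) + (- cnj b / v)" .
        qed
        then show ?thesis
          using False uv0 by simp
      next
        case rs_ne: False
        have "Q = {}"
        proof (rule ccontr)
          assume "Q \<noteq> {}"
          \<comment> \<open>The coordinate \<open>(z - r) / (z - s)\<close> sends the fixed points
            to 0 and infinity and turns \<open>T\<close> into multiplication by
            \<open>v / u\<close>.\<close>
          have "(v / u) ^ card Q = 1"
          proof (rule power_card_eq_1_if_multiplied[where h = "\<lambda>z. (z - r) / (z - s)", OF Q])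
            fix q assume q: "q \<in> Q"
            show "(T q - r) / (T q - s) = v / u * ((q - r) / (q - s))"
              using denom_ne_0[of q] by (simp add: T_r T_s Q_le q)
            show "(q - r) / (q - s) \<noteq> 0"
              using q by (simp add: Q_def)
          qed
          \<comment> \<open>The multiplier is real and positive, and 1 is the only such root of
            unity. The point is that \<open>r\<close> is fixed and unimodular, which forces
            \<open>u = \<zeta> * cnj u\<close>.\<close>
          moreover have "v / u = of_real ((1 - (norm b)^2) / (norm u)^2)"
          proof -
            have "r * cnj r = 1"
              using 3 by (simp add: complex_norm_square[symmetric])
            then have "r * (\<zeta> * cnj u) = \<zeta> * (r - b)"
              by (simp add: u_def algebra_simps)
            also have "\<dots> = r * u"
              using Tr denom_ne_0[of r] 3 by (simp add: T_def blaschke_aut_def u_def divide_simps)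
            finally have "u = \<zeta> * cnj u"
              using 3 by (metis mult_cancel_left norm_zero zero_neq_one)
            then have "u * u = \<zeta> * of_real ((norm u)^2)"
              by (metis complex_norm_square mult.commute mult.left_commute of_real_power)
            then have "v / u = u * v / (\<zeta> * of_real ((norm u)^2))"
              using uv0 by (metis mult_divide_mult_cancel_left_if)
            then show ?thesis
              using zeta_ne_0 by (simp add: uv one_minus_b_cnj_b)
          qed
          ultimately have "of_real (((1 - (norm b)^2) / (norm u)^2) ^ card Q) = (1::complex)"
            by simp
          then have "((1 - (norm b)^2) / (norm u)^2) ^ card Q = 1"
            using of_real_eq_1_iff by blast
          moreover have "card Q > 0"
            using \<open>Q \<noteq> {}\<close> Q(1) by (simp add: card_gt_0_iff)
          moreover have "(1 - (norm b)^2) / (norm u)^2 \<ge> 0"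
            using one_minus_norm_b_pos by simp
          ultimately have "(1 - (norm b)^2) / (norm u)^2 = 1"
            using power_eq_1_iff by fastforce
          then have "v / u = 1"
            unfolding \<open>v / u = _\<close> by (simp only: of_real_1)
          then have "v = u"
            using uv0 by simp
          then show False
            using rs_ne False by (simp add: u_def v_def)
        qed
        then have "P \<subseteq> {r, s}"
          by (auto simp: Q_def)
        moreover have "card {r, s} = 2"
          using rs_ne by simp
        ultimately have "P = {r, s}"
          using card by (intro card_seteq) auto
        moreover have "{z \<in> cball 0 1. T z = z} = {r, s}"
          using fixed_iff 3 by auto
        ultimately show ?thesis
          using rs_ne by simp
      qed
    qed
  qed
qed

end

section \<open>Herglotz sums and their translations\<close>

locale herglotz =
  fixes N :: nat and lam :: "nat \<Rightarrow> real" and \<alpha> :: "nat \<Rightarrow> complex"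
  assumes N_pos: "N > 0"
    and lam_pos: "\<And>j. j \<in> {1..N} \<Longrightarrow> lam j > 0"
    and norm_alpha: "\<And>j. j \<in> {1..N} \<Longrightarrow> norm (\<alpha> j) = 1"
    and inj_alpha: "inj_on \<alpha> {1..N}"
begin

definition g :: "complex \<Rightarrow> complex" where
  "g z = (\<Sum>j=1..N. of_real (lam j) * ((1 + \<alpha> j * z) / (1 - \<alpha> j * z)))"

definition den :: "complex poly" where
  "den = (\<Prod>j=1..N. [:1, - \<alpha> j:])"

text \<open>The numerator of \<open>g\<close> over the common denominator \<open>den\<close>. Both
  polynomials stay finite at the poles, so identities between them extend to the boundary.\<close>

definition num :: "complex poly" where
  "num = (\<Sum>j=1..N. smult (of_real (lam j)) ([:1, \<alpha> j:] * (\<Prod>i\<in>{1..N} - {j}. [:1, - \<alpha> i:])))"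

text \<open>As \<open>\<alpha> j\<close> is unimodular, its conjugate is its inverse, the zero of
  \<open>1 - \<alpha> j * z\<close>.\<close>

definition poles :: "complex set" where
  "poles = (\<lambda>j. cnj (\<alpha> j)) ` {1..N}"

lemma alpha_cnj: "j \<in> {1..N} \<Longrightarrow> \<alpha> j * cnj (\<alpha> j) = 1"
  using norm_alpha[of j] by (simp add: complex_norm_square[symmetric])

lemma one_minus_alpha_eq_0_iff:
  assumes "j \<in> {1..N}"
  shows "1 - \<alpha> j * z = 0 \<longleftrightarrow> z = cnj (\<alpha> j)"
proof
  assume "1 - \<alpha> j * z = 0"
  then have "cnj (\<alpha> j) * (\<alpha> j * z) = cnj (\<alpha> j)"
    by simp
  then show "z = cnj (\<alpha> j)"
    using alpha_cnj[OF assms] by (metis mult.assoc mult.commute mult_1)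
qed (use alpha_cnj[OF assms] in simp)

lemma poly_den: "poly den z = (\<Prod>j=1..N. 1 - \<alpha> j * z)"
  by (simp add: den_def poly_prod mult.commute)

lemma poly_den_eq_0_iff: "poly den z = 0 \<longleftrightarrow> z \<in> poles"
  using one_minus_alpha_eq_0_iff by (auto simp: poly_den poles_def)

lemma poly_num:
  "poly num z = (\<Sum>j=1..N. of_real (lam j) * ((1 + \<alpha> j * z) * (\<Prod>i\<in>{1..N} - {j}. 1 - \<alpha> i * z)))"
  by (simp add: num_def poly_sum poly_prod algebra_simps)

lemma poly_num_eq: "z \<notin> poles \<Longrightarrow> poly num z = g z * poly den z"
proof -
  assume z: "z \<notin> poles"
  have "of_real (lam j) * ((1 + \<alpha> j * z) * (\<Prod>i\<in>{1..N} - {j}. 1 - \<alpha> i * z))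
      = of_real (lam j) * ((1 + \<alpha> j * z) / (1 - \<alpha> j * z)) * poly den z" if j: "j \<in> {1..N}" for j
  proof -
    have "1 - \<alpha> j * z \<noteq> 0"
      using one_minus_alpha_eq_0_iff[OF j] z j by (auto simp: poles_def)
    then show ?thesis
      using prod.remove[of "{1..N}" j "\<lambda>j. 1 - \<alpha> j * z"] j by (simp add: poly_den)
  qed
  then have "poly num z = (\<Sum>j=1..N. of_real (lam j) * ((1 + \<alpha> j * z) / (1 - \<alpha> j * z)) * poly den z)"
    unfolding poly_num by (rule sum.cong[OF refl])
  then show ?thesis
    by (simp add: g_def sum_distrib_right)
qed

text \<open>At the pole belonging to \<open>k\<close> every summand but the \<open>k\<close>-th
  contains a vanishing factor, and the \<open>k\<close>-th is nonzero because the
  \<open>\<alpha> i\<close> are distinct. Hence \<open>num\<close> and \<open>den\<close> have no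
  common zero.\<close>

lemma poly_num_ne_0: "p \<in> poles \<Longrightarrow> poly num p \<noteq> 0"
proof -
  assume "p \<in> poles"
  then obtain k where k: "k \<in> {1..N}" "p = cnj (\<alpha> k)"
    by (auto simp: poles_def)
  have zero: "(\<Prod>i\<in>{1..N} - {j}. 1 - \<alpha> i * p) = 0" if "j \<in> {1..N}" "j \<noteq> k" for j
    using k that one_minus_alpha_eq_0_iff[of k p] by (intro prod_zero) auto
  have "poly num p = (\<Sum>j=1..N. if j = k then of_real (lam k) * (2 * (\<Prod>i\<in>{1..N} - {k}. 1 - \<alpha> i * p)) else 0)"
    unfolding poly_num
  proof (rule sum.cong[OF refl])
    fix j assume j: "j \<in> {1..N}"
    show "of_real (lam j) * ((1 + \<alpha> j * p) * (\<Prod>i\<in>{1..N} - {j}. 1 - \<alpha> i * p))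
        = (if j = k then of_real (lam k) * (2 * (\<Prod>i\<in>{1..N} - {k}. 1 - \<alpha> i * p)) else 0)"
    proof (cases "j = k")
      case True
      moreover have "1 + \<alpha> k * p = 2"
        using alpha_cnj[OF k(1)] k(2) by simp
      ultimately show ?thesis
        by simp
    next
      case False
      then show ?thesis
        by (simp only: zero[OF j False] mult_zero_right if_False)
    qed
  qed
  also have "\<dots> = of_real (lam k) * (2 * (\<Prod>i\<in>{1..N} - {k}. 1 - \<alpha> i * p))"
    using k by simp
  also have "\<dots> \<noteq> 0"
  proof -
    have "1 - \<alpha> i * p \<noteq> 0" if "i \<in> {1..N} - {k}" for i
      using that k one_minus_alpha_eq_0_iff[of i p] inj_alpha by (auto dest: inj_onD)
    then show ?thesis
      using lam_pos[OF k(1)] by simp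
  qed
  finally show ?thesis .
qed

lemma finite_poles: "finite poles"
  by (simp add: poles_def)

lemma card_poles: "card poles = N"
proof -
  have "inj_on (\<lambda>j. cnj (\<alpha> j)) {1..N}"
    using inj_alpha unfolding inj_on_def complex_cnj_cancel_iff .
  then show ?thesis
    by (simp add: poles_def card_image)
qed

lemma norm_poles: "p \<in> poles \<Longrightarrow> norm p = 1"
  using norm_alpha by (auto simp: poles_def)

text \<open>Each summand has as real part a positive multiple of the Poisson kernel
  \<open>(1 - (norm z)^2) / (norm (1 - \<alpha> j * z))^2\<close>, so the sign is that of
  \<open>1 - (norm z)^2\<close>.\<close>

lemma Re_g_pos_iff:
  assumes "z \<notin> poles"
  shows "Re (g z) > 0 \<longleftrightarrow> norm z < 1"
proof -
  define S where "S = (\<Sum>j=1..N. lam j / (norm (1 - \<alpha> j * z))^2)"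
  have "Re (g z) = (\<Sum>j=1..N. (1 - (norm z)^2) * (lam j / (norm (1 - \<alpha> j * z))^2))"
    unfolding g_def Re_sum
  proof (rule sum.cong)
    fix j assume j: "j \<in> {1..N}"
    define u where "u = \<alpha> j * z"
    have "norm u = norm z"
      using norm_alpha[OF j] by (simp add: u_def norm_mult)
    moreover have "(1 + u) * (1 - cnj u) = of_real (1 - (norm u)^2) + (u - cnj u)"
      unfolding of_real_diff complex_norm_square by (simp add: algebra_simps)
    then have "Re ((1 + u) * cnj (1 - u)) = 1 - (norm u)^2"
      by simp
    then have "Re ((1 + u) / (1 - u)) = (1 - (norm u)^2) / (norm (1 - u))^2"
      unfolding complex_div_cnj[of "1 + u"]
      by (simp add: Re_divide_of_real flip: of_real_power)
    moreover have "Re (of_real (lam j) * ((1 + u) / (1 - u))) = lam j * Re ((1 + u) / (1 - u))"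
      by (simp only: times_complex.sel Re_complex_of_real Im_complex_of_real)
    ultimately show "Re (of_real (lam j) * ((1 + \<alpha> j * z) / (1 - \<alpha> j * z)))
        = (1 - (norm z)^2) * (lam j / (norm (1 - \<alpha> j * z))^2)"
      unfolding u_def by simp
  qed simp
  then have eq: "Re (g z) = (1 - (norm z)^2) * S"
    by (simp add: S_def sum_distrib_left)
  have "S > 0"
    unfolding S_def
  proof (rule sum_pos)
    fix j assume j: "j \<in> {1..N}"
    then have "1 - \<alpha> j * z \<noteq> 0"
      using one_minus_alpha_eq_0_iff[OF j] assms by (auto simp: poles_def)
    then show "lam j / (norm (1 - \<alpha> j * z))^2 > 0"
      using lam_pos[OF j] by simp
  qed (use N_pos in auto)
  then show ?thesis
    unfolding eq by (simp add: zero_less_mult_iff abs_square_less_1)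
qed

lemma disc_not_poles: "z \<in> unit_disc \<Longrightarrow> z \<notin> poles"
  using norm_poles by force

lemma Re_g_pos: "z \<in> unit_disc \<Longrightarrow> Re (g z) > 0"
  using Re_g_pos_iff disc_not_poles by simp

lemma holomorphic_on_g: "g holomorphic_on unit_disc"
  unfolding g_def
proof (intro holomorphic_intros)
  fix z j assume "z \<in> unit_disc" "j \<in> {1..N}"
  then show "1 - \<alpha> j * z \<noteq> 0"
    using one_minus_alpha_eq_0_iff[of j z] disc_not_poles[of z] by (auto simp: poles_def)
qed

text \<open>A root could a priori lie anywhere in the plane. A pole is not a root since
  \<open>num\<close> does not vanish there, and at any other point a positive real part of
  \<open>g\<close> forces the point into the disc.\<close>

lemma fibre_eq_roots:
  assumes "Re w > 0"
  shows "poly (num - smult w den) z = 0 \<longleftrightarrow> z \<in> unit_disc \<and> g z = w"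
proof (cases "z \<in> poles")
  case True
  then have "poly den z = 0"
    by (simp add: poly_den_eq_0_iff)
  then show ?thesis
    using True poly_num_ne_0 disc_not_poles by auto
next
  case False
  then have "poly den z \<noteq> 0"
    by (simp add: poly_den_eq_0_iff)
  then show ?thesis
    using poly_num_eq[OF False] Re_g_pos_iff[OF False] assms by auto
qed

lemma alpha_ne_0: "j \<in> {1..N} \<Longrightarrow> \<alpha> j \<noteq> 0"
  using norm_alpha by force

text \<open>Each product in \<open>num\<close> has top coefficient \<open>- L\<close>, where
  \<open>L\<close> is that of \<open>den\<close>. The degree could drop only if \<open>w\<close>
  were the value of \<open>g\<close> at infinity, minus the sum of the \<open>lam j\<close>, whose
  real part is negative.\<close>

lemma degree_fibre_poly:
  assumes "Re w > 0"
  shows "degree (num - smult w den) = N"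
proof (rule antisym)
  define L where "L = (\<Prod>j=1..N. - \<alpha> j)"
  have "L \<noteq> 0"
    using alpha_ne_0 by (auto simp: L_def)
  have den: "degree den = N" "coeff den N = L"
    using degree_coeff_linear_prod[of "{1..N}" "\<lambda>j. - \<alpha> j"] alpha_ne_0
    by (auto simp: den_def L_def)
  define t where "t j = [:1, \<alpha> j:] * (\<Prod>i\<in>{1..N} - {j}. [:1, - \<alpha> i:])" for j
  have t: "degree (t j) = N" "coeff (t j) N = - L" if j: "j \<in> {1..N}" for j
  proof -
    define q where "q = (\<Prod>i\<in>{1..N} - {j}. [:1, - \<alpha> i:])"
    have q: "degree q = N - 1" "coeff q (N - 1) = (\<Prod>i\<in>{1..N} - {j}. - \<alpha> i)"
      using degree_coeff_linear_prod[of "{1..N} - {j}" "\<lambda>j. - \<alpha> j"] alpha_ne_0 j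
      by (auto simp: q_def)
    have "q \<noteq> 0"
      by (auto simp: q_def)
    then show deg: "degree (t j) = N"
      using alpha_ne_0[OF j] q N_pos unfolding t_def q_def[symmetric]
      by (subst degree_mult_eq) auto
    have "coeff (t j) N = lead_coeff (t j)"
      using deg by simp
    also have "\<dots> = \<alpha> j * coeff q (N - 1)"
      unfolding t_def q_def[symmetric] lead_coeff_mult using alpha_ne_0[OF j] q by simp
    also have "\<dots> = - L"
      unfolding q(2) L_def using prod.remove[of "{1..N}" j "\<lambda>j. - \<alpha> j"] j by simp
    finally show "coeff (t j) N = - L" .
  qed
  have num: "num = (\<Sum>j=1..N. smult (of_real (lam j)) (t j))"
    by (simp add: num_def t_def)
  have "degree num \<le> N"
    unfolding num using t by (intro degree_sum_le) (auto intro: order.trans[OF degree_smult_le])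
  then show "degree (num - smult w den) \<le> N"
    using den degree_smult_le[of w den] by (intro degree_diff_le) auto
  have "coeff (num - smult w den) N = - (of_real (\<Sum>j=1..N. lam j) + w) * L"
    unfolding num by (simp add: coeff_sum t den algebra_simps sum_distrib_left sum_negf)
  moreover have "of_real (\<Sum>j=1..N. lam j) + w \<noteq> 0"
  proof -
    have "Re (of_real (\<Sum>j=1..N. lam j) + w) > 0"
      using assms lam_pos by (auto intro!: add_nonneg_pos sum_nonneg simp: less_imp_le)
    then show ?thesis
      by (metis less_irrefl zero_complex.sel(1))
  qed
  ultimately have "coeff (num - smult w den) N \<noteq> 0"
    using \<open>L \<noteq> 0\<close> by (simp only: mult_eq_0_iff neg_equal_0_iff_equal) simp
  then show "N \<le> degree (num - smult w den)"
    by (rule le_degree)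
qed

section \<open>Counting points in the fibres\<close>

definition fibre :: "complex \<Rightarrow> complex set" where
  "fibre w = {z \<in> unit_disc. g z = w}"

lemma fibre_roots: "Re w > 0 \<Longrightarrow> fibre w = {z. poly (num - smult w den) z = 0}"
  using fibre_eq_roots by (auto simp: fibre_def)

lemma finite_card_fibre:
  assumes "Re w > 0"
  shows "finite (fibre w)" "card (fibre w) \<le> N"
proof -
  have ne: "num - smult w den \<noteq> 0"
    using degree_fibre_poly[OF assms] N_pos by auto
  show "finite (fibre w)"
    unfolding fibre_roots[OF assms] using ne by (rule poly_roots_finite)
  show "card (fibre w) \<le> N"
    using card_poly_roots_bound[OF ne]
    unfolding fibre_roots[OF assms] degree_fibre_poly[OF assms] .
qed

text \<open>A multiple root of \<open>num - smult w den\<close> is a zero of the Wronskian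
  \<open>W\<close>, which does not depend on \<open>w\<close>. At a pole \<open>W\<close> equals
  \<open>- num * pderiv den\<close>, which is nonzero as \<open>den\<close> has simple zeros, so
  \<open>W\<close> has finitely many zeros.\<close>

lemma finite_critical_points:
  obtains C where "finite C"
    "\<And>w. \<lbrakk>Re w > 0; fibre w \<inter> C = {}\<rbrakk> \<Longrightarrow> card (fibre w) = N"
proof
  define W where "W = pderiv num * den - num * pderiv den"
  have "W \<noteq> 0"
  proof
    assume "W = 0"
    obtain k where k: "k \<in> {1..N}"
      using N_pos by (metis One_nat_def Suc_leI atLeastAtMost_iff order_refl)
    define p where "p = cnj (\<alpha> k)"
    have p: "p \<in> poles"
      using k by (auto simp: p_def poles_def)
    define q where "q = (\<Prod>i\<in>{1..N} - {k}. [:1, - \<alpha> i:])"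
    have "poly q p \<noteq> 0"
    proof -
      have "1 - \<alpha> i * p \<noteq> 0" if "i \<in> {1..N} - {k}" for i
        using that k one_minus_alpha_eq_0_iff[of i p] inj_alpha by (auto simp: p_def dest: inj_onD)
      then show ?thesis
        by (auto simp: q_def poly_prod mult.commute)
    qed
    have den: "den = [:1, - \<alpha> k:] * q"
      unfolding den_def q_def using k by (intro prod.remove) auto
    have "1 - \<alpha> k * p = 0"
      using one_minus_alpha_eq_0_iff[OF k] by (simp add: p_def)
    then have "poly [:1, - \<alpha> k:] p = 0"
      by (simp add: mult.commute)
    then have "poly (pderiv den) p = - \<alpha> k * poly q p"
      unfolding den pderiv_mult poly_add poly_mult by (simp add: pderiv_pCons)
    then have "poly (pderiv den) p \<noteq> 0"
      using \<open>poly q p \<noteq> 0\<close> alpha_ne_0[OF k] by simp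
    moreover have "poly W p = - (poly num p * poly (pderiv den) p)"
      using poly_den_eq_0_iff p by (simp add: W_def)
    ultimately show False
      using \<open>W = 0\<close> poly_num_ne_0[OF p] by simp
  qed
  then show "finite {z. poly W z = 0}"
    by (rule poly_roots_finite)
  fix w :: complex assume w: "Re w > 0" "fibre w \<inter> {z. poly W z = 0} = {}"
  have "rsquarefree (num - smult w den)"
    unfolding rsquarefree_roots
  proof (intro allI notI)
    fix z assume z: "poly (num - smult w den) z = 0 \<and> poly (pderiv (num - smult w den)) z = 0"
    then have "poly num z = w * poly den z" "poly (pderiv num) z = w * poly (pderiv den) z"
      by (auto simp: pderiv_diff pderiv_smult)
    then have "poly W z = 0"
      by (simp add: W_def)
    moreover have "z \<in> fibre w"
      using z fibre_roots[OF w(1)] by simp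
    ultimately show False
      using w(2) by blast
  qed
  then show "card (fibre w) = N"
    using card_roots_rsquarefree degree_fibre_poly w(1) by (metis fibre_roots)
qed

end

section \<open>Self-maps of the disc that translate the Herglotz sum\<close>

text \<open>With \<open>c\<close> imaginary, \<open>w\<close>, \<open>w + c\<close> and
  \<open>w - c\<close> lie in the right half plane together, so the facts on fibres apply to all
  three.\<close>

locale herglotz_translation = herglotz +
  fixes \<psi> :: "complex \<Rightarrow> complex" and c :: complex
  assumes psi_hol: "\<psi> holomorphic_on unit_disc"
    and psi_maps: "\<psi> ` unit_disc \<subseteq> unit_disc"
    and Re_c: "Re c = 0"
    and g_psi: "\<And>z. z \<in> unit_disc \<Longrightarrow> g (\<psi> z) = g z + c"
begin

lemma psi_in: "z \<in> unit_disc \<Longrightarrow> \<psi> z \<in> unit_disc"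
  using psi_maps by blast

lemma psi_nonconstant: "\<not> \<psi> constant_on unit_disc"
proof
  assume "\<psi> constant_on unit_disc"
  then obtain d where "\<And>z. z \<in> unit_disc \<Longrightarrow> \<psi> z = d"
    unfolding constant_on_def by blast
  then have "unit_disc \<subseteq> fibre (g d - c)"
    using g_psi by (fastforce simp: fibre_def)
  moreover have "d \<in> unit_disc"
    using psi_in[of 0] \<open>\<And>z. z \<in> unit_disc \<Longrightarrow> \<psi> z = d\<close>[of 0] by simp
  then have "finite (fibre (g d - c))"
    using Re_g_pos Re_c by (intro finite_card_fibre) simp
  ultimately have "finite unit_disc"
    using finite_subset by blast
  then show False
    using finite_imp_not_open[of unit_disc] by simp
qed

text \<open>The image is open by the open mapping theorem. It is relatively closed because preimages
  of a sequence converging in the disc cannot accumulate at the circle: their limit is a root of a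
  fibre polynomial. Connectedness concludes.\<close>

lemma psi_surj: "\<psi> ` unit_disc = unit_disc"
proof -
  have "open (\<psi> ` unit_disc)"
    using open_mapping_thm[OF psi_hol _ _ _ _ psi_nonconstant] by simp
  moreover have "closedin (top_of_set unit_disc) (\<psi> ` unit_disc)"
    unfolding closedin_limpt
  proof (intro conjI allI impI)
    fix l assume l: "l islimpt \<psi> ` unit_disc \<and> l \<in> unit_disc"
    then obtain u where u: "\<And>k. u k \<in> \<psi> ` unit_disc" "u \<longlonglongrightarrow> l"
      unfolding islimpt_sequential by blast
    then obtain z where z: "\<And>k. z k \<in> unit_disc" "\<And>k. u k = \<psi> (z k)"
      unfolding image_iff by metis
    then have "\<forall>k. z k \<in> cball 0 1"
      using ball_subset_cball by blast
    then obtain y \<phi> where y: "y \<in> cball 0 1" "strict_mono (\<phi>::nat\<Rightarrow>nat)" "(z \<circ> \<phi>) \<longlonglongrightarrow> y"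
      using compact_cball[of "0::complex" 1] unfolding compact_def by blast
    have u\<phi>: "(\<lambda>k. u (\<phi> k)) \<longlonglongrightarrow> l"
      using LIMSEQ_subseq_LIMSEQ[OF u(2) y(2)] by (simp add: o_def)
    have z\<phi>: "(\<lambda>k. z (\<phi> k)) \<longlonglongrightarrow> y"
      using y(3) by (simp add: o_def)
    have "isCont g l"
      using holomorphic_on_imp_continuous_on[OF holomorphic_on_g] l
        continuous_on_eq_continuous_at[OF open_ball] by blast
    then have "(\<lambda>k. g (u (\<phi> k))) \<longlonglongrightarrow> g l"
      using u\<phi> by (rule isCont_tendsto_compose)
    \<comment> \<open>The factor \<open>den\<close> clears denominators, since the limit
      \<open>y\<close> could so far be a pole of \<open>g\<close>.\<close>
    then have "(\<lambda>k. (g (u (\<phi> k)) - c) * poly den (z (\<phi> k))) \<longlonglongrightarrow> (g l - c) * poly den y"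
      by (intro tendsto_intros z\<phi>)
    moreover have "(g (u k) - c) * poly den (z k) = poly num (z k)" for k
      using z g_psi poly_num_eq disc_not_poles by simp
    ultimately have "(\<lambda>k. poly num (z (\<phi> k))) \<longlonglongrightarrow> (g l - c) * poly den y"
      by simp
    moreover have "(\<lambda>k. poly num (z (\<phi> k))) \<longlonglongrightarrow> poly num y"
      by (intro tendsto_intros z\<phi>)
    ultimately have "poly num y = (g l - c) * poly den y"
      using LIMSEQ_unique by blast
    then have "y \<in> unit_disc"
      using fibre_eq_roots[of "g l - c" y] Re_g_pos[of l] Re_c l by simp
    then have "isCont \<psi> y"
      using holomorphic_on_imp_continuous_on[OF psi_hol]
        continuous_on_eq_continuous_at[OF open_ball] by blast
    then have "(\<lambda>k. \<psi> (z (\<phi> k))) \<longlonglongrightarrow> \<psi> y"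
      using z\<phi> by (rule isCont_tendsto_compose)
    then have "\<psi> y = l"
      using u\<phi> LIMSEQ_unique by (simp add: z(2))
    then show "l \<in> \<psi> ` unit_disc"
      using \<open>y \<in> unit_disc\<close> by blast
  qed (rule psi_maps)
  ultimately have "\<psi> ` unit_disc = {} \<or> \<psi> ` unit_disc = unit_disc"
    using connected_clopen[of unit_disc] open_subset[OF psi_maps] by blast
  then show ?thesis
    by simp
qed

text \<open>By surjectivity \<open>\<psi>\<close> maps the fibre over \<open>w\<close> onto the
  fibre over \<open>w + c\<close>. If the latter has \<open>N\<close> points, the former, with at
  most \<open>N\<close>, is mapped bijectively.\<close>

lemma inj_on_psi: "inj_on \<psi> unit_disc"
proof -
  obtain C where C: "finite C" "\<And>w. \<lbrakk>Re w > 0; fibre w \<inter> C = {}\<rbrakk> \<Longrightarrow> card (fibre w) = N"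
    using finite_critical_points by blast
  \<comment> \<open>A point outside \<open>E\<close> lies in a fibre free of critical points, hence
    in one with exactly \<open>N\<close> points.\<close>
  define E where "E = (\<Union>z\<in>C \<inter> unit_disc. fibre (g z))"
  show ?thesis
  proof (rule holomorphic_inj_on_if_generically_inj[OF psi_hol _ _ psi_nonconstant])
    show "finite E"
      unfolding E_def using C(1) finite_card_fibre Re_g_pos by blast
    fix x y assume xy: "x \<in> unit_disc" "y \<in> unit_disc" "\<psi> x = \<psi> y" "\<psi> x \<notin> E"
    define w where "w = g x"
    have Re_w: "Re w > 0"
      using xy Re_g_pos by (simp add: w_def)
    have image: "\<psi> ` fibre w = fibre (w + c)"
    proof
      show "\<psi> ` fibre w \<subseteq> fibre (w + c)"
        using g_psi psi_in by (auto simp: fibre_def simp del: mem_ball)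
      show "fibre (w + c) \<subseteq> \<psi> ` fibre w"
      proof
        fix v assume v: "v \<in> fibre (w + c)"
        then obtain z where "z \<in> unit_disc" "v = \<psi> z"
          using psi_surj unfolding fibre_def by blast
        then show "v \<in> \<psi> ` fibre w"
          using v g_psi by (auto simp: fibre_def)
      qed
    qed
    have psi_x: "\<psi> x \<in> fibre (w + c)"
      using g_psi[OF xy(1)] psi_in[OF xy(1)] by (simp add: fibre_def w_def)
    have "fibre (w + c) \<inter> C = {}"
    proof (rule ccontr)
      assume "fibre (w + c) \<inter> C \<noteq> {}"
      then obtain z where "z \<in> C" "z \<in> unit_disc" "g z = w + c"
        by (auto simp: fibre_def)
      then have "\<psi> x \<in> E"
        using psi_x by (force simp: E_def)
      then show False
        using xy(4) by simp
    qed
    then have "card (\<psi> ` fibre w) = N"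
      using C(2) Re_w Re_c image by simp
    moreover have "card (fibre w) \<le> N" "finite (fibre w)"
      using finite_card_fibre Re_w by auto
    ultimately have "inj_on \<psi> (fibre w)"
      by (intro eq_card_imp_inj_on) (use card_image_le[of "fibre w" \<psi>] in auto)
    moreover have "g x = g y"
      using g_psi[OF xy(1)] g_psi[OF xy(2)] xy(3) by simp
    then have "x \<in> fibre w" "y \<in> fibre w"
      using xy by (auto simp: fibre_def w_def)
    ultimately show "x = y"
      using xy(3) by (meson inj_onD)
  qed auto
qed

lemma disc_aut_psi: "disc_aut \<psi>"
proof -
  obtain h where h: "h holomorphic_on (\<psi> ` unit_disc)" "\<And>z. z \<in> unit_disc \<Longrightarrow> h (\<psi> z) = z"
    using holomorphic_has_inverse[OF psi_hol open_ball inj_on_psi] by metis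
  have inv: "\<psi> (h z) = z \<and> h z \<in> unit_disc" if z: "z \<in> unit_disc" for z
  proof -
    obtain y where "y \<in> unit_disc" "z = \<psi> y"
      using z psi_surj by blast
    then show ?thesis
      using h(2) by simp
  qed
  show ?thesis
    unfolding disc_aut_def
  proof (intro conjI exI[of _ h] ballI)
    show "h holomorphic_on unit_disc" "h ` unit_disc \<subseteq> unit_disc"
      using h(1) inv unfolding psi_surj by blast+
  qed (use psi_hol psi_maps h(2) inv in blast)+
qed

text \<open>Cleared of denominators, the relation between \<open>g (T z)\<close> and
  \<open>g z\<close> extends by continuity to the closed disc. At a pole \<open>p\<close> it reduces
  to \<open>poly num p * poly den (T p) = 0\<close>, so \<open>T p\<close> is a pole. Finiteness and
  injectivity give equality.\<close>

lemma poles_invariant: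
  assumes ext: "\<And>z. z \<in> unit_disc \<Longrightarrow> T z = \<psi> z" and cont: "continuous_on (cball 0 1) T"
    and inj: "inj_on T (cball 0 1)"
  shows "T ` poles = poles"
proof -
  have *: "poly num (T z) * poly den z - (poly num z + c * poly den z) * poly den (T z) = 0"
    if "z \<in> cball 0 1" for z
  proof (rule continuous_constant_on_closure[where S = unit_disc and x = z])
    show "continuous_on (closure unit_disc)
      (\<lambda>z. poly num (T z) * poly den z - (poly num z + c * poly den z) * poly den (T z))"
      using cont by (auto intro!: continuous_intros)
    show "poly num (T z) * poly den z - (poly num z + c * poly den z) * poly den (T z) = 0"
      if "z \<in> unit_disc" for z
      using that ext psi_in[OF that] poly_num_eq disc_not_poles g_psi
      by (simp add: algebra_simps)
    show "z \<in> closure unit_disc"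
      using that by simp
  qed
  have sub: "poles \<subseteq> cball 0 1"
    using norm_poles by auto
  show ?thesis
  proof (rule endo_inj_surj[OF finite_poles])
    show "inj_on T poles"
      using inj sub by (rule inj_on_subset)
    show "T ` poles \<subseteq> poles"
    proof
      fix y assume "y \<in> T ` poles"
      then obtain p where p: "p \<in> poles" "y = T p"
        by blast
      then have "poly num p * poly den (T p) = 0"
        using *[of p] sub poly_den_eq_0_iff[of p] by auto
      then show "y \<in> poles"
        using poly_num_ne_0 p poly_den_eq_0_iff by simp
    qed
  qed
qed

end

section \<open>Symmetries of extremal functions\<close>

lemma not_extremal_const_1:
  assumes "n > 0" "\<And>z. z \<in> unit_disc \<Longrightarrow> f z = 1"
  shows "\<not> extremal n f"
proof
  assume ext: "extremal n f"
  \<comment> \<open>The modulus of \<open>F\<close> stays between 1/3 and 1, and its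
    \<open>n\<close>-th coefficient is 1/3, against 0 for the constant. The form
    \<open>z - 0\<close> matches \<open>higher_deriv_power\<close>.\<close>
  define F :: "complex \<Rightarrow> complex" where "F z = 2/3 + (1/3) * (z - 0) ^ n" for z
  have "F \<in> B0"
    unfolding B0_def
  proof (intro CollectI conjI ballI)
    show "F holomorphic_on unit_disc"
      unfolding F_def by (intro holomorphic_intros)
    fix z :: complex assume "z \<in> unit_disc"
    then have "norm (z ^ n) < 1"
      using assms(1) by (simp add: norm_power power_less_one_iff)
    then have "norm ((1/3) * z ^ n) < 1/3"
      by (simp add: norm_mult)
    moreover have "norm (2/3::complex) = 2/3"
      by simp
    ultimately show "0 < norm (F z)" "norm (F z) \<le> 1"
      using norm_triangle_ineq[of "2/3" "(1/3) * z ^ n"] norm_diff_ineq[of "2/3" "(1/3) * z ^ n"]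
      unfolding F_def diff_zero by linarith+
  qed
  have deriv_F: "(deriv ^^ n) F 0 = (1/3) * fact n"
  proof -
    have "(deriv ^^ n) F 0 = (deriv ^^ n) (\<lambda>z. 2/3) 0 + (deriv ^^ n) (\<lambda>z. (1/3) * (z - 0) ^ n) 0"
      unfolding F_def by (rule higher_deriv_add[of _ UNIV]) (auto intro!: holomorphic_intros)
    also have "(deriv ^^ n) (\<lambda>z. (1/3) * (z - 0) ^ n) 0 = (1/3) * (deriv ^^ n) (\<lambda>z::complex. (z - 0) ^ n) 0"
      by (rule higher_deriv_cmult[of _ UNIV]) (auto intro!: holomorphic_intros)
    also have "(deriv ^^ n) (\<lambda>z::complex. (z - 0) ^ n) 0 = fact n"
      unfolding higher_deriv_power by (simp add: pochhammer_fact)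
    finally show ?thesis
      using assms(1) by simp
  qed
  have "M n F = 1/3"
    unfolding M_def taylor_coeff_def deriv_F by simp
  moreover have "(deriv ^^ n) f 0 = (deriv ^^ n) (\<lambda>z. 1) 0"
    by (rule higher_deriv_transform_within_open[of _ unit_disc])
      (use ext assms(2) in \<open>auto simp: extremal_def B0_def\<close>)
  then have "M n f = 0"
    using assms(1) by (simp add: M_def taylor_coeff_def)
  ultimately show False
    using ext \<open>F \<in> B0\<close> by (auto simp: extremal_def)
qed

theorem theorem3:
  fixes n N :: nat and f \<psi> :: "complex \<Rightarrow> complex"
    and lam :: "nat \<Rightarrow> real" and \<alpha> :: "nat \<Rightarrow> complex"
  assumes n3: "n \<ge> 3"
    and ext: "extremal n f"
    and N_le: "N \<le> n"
    and lam_pos: "\<forall>j\<in>{1..N}. lam j > 0"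
    and alpha_bd: "\<forall>j\<in>{1..N}. norm (\<alpha> j) = 1"
    and alpha_dist: "inj_on \<alpha> {1..N}"
    and f_repr: "\<forall>z\<in>unit_disc.
        f z = exp (- (\<Sum>j=1..N. of_real (lam j) * ((1 + \<alpha> j * z) / (1 - \<alpha> j * z))))"
    and psi_hol: "\<psi> holomorphic_on unit_disc"
    and psi_maps: "\<psi> ` unit_disc \<subseteq> unit_disc"
    and comp: "\<forall>z\<in>unit_disc. f (\<psi> z) = f z"
  shows "disc_aut \<psi> \<and>
    (N \<ge> 3 \<longrightarrow>
       (\<exists>a\<in>unit_disc. \<exists>\<xi>. \<xi> ^ N = 1 \<and>
          (\<forall>z\<in>unit_disc. \<psi> z = blaschke_aut (- a) (\<xi> * blaschke_aut a z)) \<and>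
          \<psi> a = a \<and> (\<forall>z\<in>unit_disc. (\<psi> ^^ N) z = z))) \<and>
    (N = 2 \<longrightarrow>
       (\<exists>a\<in>unit_disc. \<exists>\<xi>. \<xi> ^ N = 1 \<and>
          (\<forall>z\<in>unit_disc. \<psi> z = blaschke_aut (- a) (\<xi> * blaschke_aut a z)))
       \<or> (\<exists>\<Psi>. continuous_on (cball 0 1) \<Psi> \<and> (\<forall>z\<in>unit_disc. \<Psi> z = \<psi> z) \<and>
            {z \<in> cball 0 1. \<Psi> z = z} = {cnj (\<alpha> 1), cnj (\<alpha> 2)}))"
proof -
  have "N > 0"
  proof (rule ccontr)
    assume "\<not> N > 0"
    then have "f z = 1" if "z \<in> unit_disc" for z
      using f_repr that by simp
    then show False
      using not_extremal_const_1[of n f] n3 ext by simp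
  qed
  then interpret herglotz N lam \<alpha>
    using lam_pos alpha_bd alpha_dist by unfold_locales auto
  have f_exp: "f z = exp (- g z)" if "z \<in> unit_disc" for z
    using f_repr that by (simp add: g_def)
  have psi_in: "\<psi> z \<in> unit_disc" if "z \<in> unit_disc" for z
    using psi_maps that by blast
  \<comment> \<open>Invariance of \<open>f\<close> determines \<open>g\<close> only up to a period
    of \<open>exp\<close>; connectedness of the disc makes that period constant.\<close>
  have "exp (g (\<psi> z) - g z) = 1" if z: "z \<in> unit_disc" for z
  proof -
    have "exp (- g (\<psi> z)) = exp (- g z)"
      using f_exp[OF z] f_exp[OF psi_in[OF z]] comp z by simp
    then show ?thesis
      by (simp add: exp_minus exp_diff)
  qed
  moreover have "continuous_on unit_disc (\<lambda>z. g (\<psi> z) - g z)"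
    using holomorphic_on_g psi_hol psi_maps
    by (intro continuous_intros continuous_on_compose2[of unit_disc g _ \<psi>] holomorphic_on_imp_continuous_on) auto
  ultimately obtain c where c: "Re c = 0" "\<And>z. z \<in> unit_disc \<Longrightarrow> g (\<psi> z) - g z = c"
    using exp_eq_1_imp_constant[of unit_disc "\<lambda>z. g (\<psi> z) - g z"] by auto
  interpret herglotz_translation N lam \<alpha> \<psi> c
  proof unfold_locales
    show "g (\<psi> z) = g z + c" if "z \<in> unit_disc" for z
      using c(2)[OF that] by (simp add: algebra_simps)
  qed (use psi_hol psi_maps c in auto)
  obtain \<zeta> b where \<zeta>: "norm \<zeta> = 1" "norm b < 1"
    and psi_eq: "\<And>z. z \<in> unit_disc \<Longrightarrow> \<psi> z = \<zeta> * blaschke_aut b z"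
    using disc_automorphism_moebius[OF disc_aut_psi] by blast
  interpret disc_moebius \<zeta> b
    using \<zeta> by unfold_locales
  have T_psi: "T z = \<psi> z" if "z \<in> unit_disc" for z
    using psi_eq[OF that] by (simp add: T_def)
  have poles: "T ` poles = poles" "poles \<subseteq> sphere 0 1"
    using norm_poles poles_invariant T_psi continuous_on_T inj_on_T by auto
  \<comment> \<open>For \<open>N = 1\<close> only the automorphism claim is made.\<close>
  have dichotomy: "(\<exists>a \<xi>. norm a < 1 \<and> \<xi> ^ N = 1 \<and>
            (\<forall>z. norm z \<le> 1 \<longrightarrow> blaschke_aut a (T z) = \<xi> * blaschke_aut a z))
       \<or> N = 2 \<and> {z \<in> cball 0 1. T z = z} = poles" if "N \<ge> 2"
    using T_invariant_set[OF finite_poles poles(2,1)] that unfolding card_poles by blast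
  have elliptic: "\<exists>a\<in>unit_disc. \<exists>\<xi>. \<xi> ^ N = 1 \<and>
          (\<forall>z\<in>unit_disc. \<psi> z = blaschke_aut (- a) (\<xi> * blaschke_aut a z)) \<and>
          \<psi> a = a \<and> (\<forall>z\<in>unit_disc. (\<psi> ^^ N) z = z)"
    if "norm a < 1" "\<xi> ^ N = 1"
      "\<forall>z. norm z \<le> 1 \<longrightarrow> blaschke_aut a (T z) = \<xi> * blaschke_aut a z" for a \<xi>
  proof -
    have conj: "blaschke_aut a (\<psi> z) = \<xi> * blaschke_aut a z" if "z \<in> unit_disc" for z
      using T_psi[OF that] \<open>\<forall>z. norm z \<le> 1 \<longrightarrow> _\<close> that by (metis less_imp_le mem_ball_0)
    show ?thesis
      using conjugate_rotation_form[OF that(1) psi_maps that(2) conj] that(1,2)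
      by (intro bexI[of _ a] exI[of _ \<xi>]) auto
  qed
  show ?thesis
  proof (intro conjI impI disc_aut_psi)
    assume "N \<ge> 3"
    then show "\<exists>a\<in>unit_disc. \<exists>\<xi>. \<xi> ^ N = 1 \<and>
          (\<forall>z\<in>unit_disc. \<psi> z = blaschke_aut (- a) (\<xi> * blaschke_aut a z)) \<and>
          \<psi> a = a \<and> (\<forall>z\<in>unit_disc. (\<psi> ^^ N) z = z)"
      using dichotomy elliptic by auto
  next
    assume N: "N = 2"
    then have "{1..N} = {1, 2}"
      by auto
    then have poles_eq: "poles = {cnj (\<alpha> 1), cnj (\<alpha> 2)}"
      unfolding poles_def by simp
    consider a \<xi> where "norm a < 1" "\<xi> ^ N = 1"
        "\<forall>z. norm z \<le> 1 \<longrightarrow> blaschke_aut a (T z) = \<xi> * blaschke_aut a z"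
      | "{z \<in> cball 0 1. T z = z} = poles"
      using dichotomy N by auto
    then show "(\<exists>a\<in>unit_disc. \<exists>\<xi>. \<xi> ^ N = 1 \<and>
          (\<forall>z\<in>unit_disc. \<psi> z = blaschke_aut (- a) (\<xi> * blaschke_aut a z)))
       \<or> (\<exists>\<Psi>. continuous_on (cball 0 1) \<Psi> \<and> (\<forall>z\<in>unit_disc. \<Psi> z = \<psi> z) \<and>
            {z \<in> cball 0 1. \<Psi> z = z} = {cnj (\<alpha> 1), cnj (\<alpha> 2)})"
    proof cases
      case (1 a \<xi>)
      then show ?thesis
        using elliptic[OF 1] by blast
    next
      case 2
      \<comment> \<open>Fixed points on the circle are those of the continuous extension of
        \<open>\<psi>\<close>, and \<open>T\<close> is that extension.\<close>
      have "continuous_on (cball 0 1) T \<and> (\<forall>z\<in>unit_disc. T z = \<psi> z) \<and>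
          {z \<in> cball 0 1. T z = z} = {cnj (\<alpha> 1), cnj (\<alpha> 2)}"
        using continuous_on_T T_psi 2 poles_eq by blast
      then show ?thesis
        by blast
    qed
  qed
qed

end
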